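(* Assume: (A1) for every $(t,x)\in[0,T]\times\mathbb{R}^d$, $f(t,x,\cdot,\cdot)\in C^1(\mathbb{R}^m\times\mathbb{R}^{m\times d};\mathbb{R}^m)$ and $\sigma(t,x,\cdot)\in C^1(\mathbb{R}^m;\mathbb{R}^{d\times d})$, and there are constants $C_{f,z},C_{\sigma,y},C_\sigma>0$ with $\sup_{t,x,y,z}\|D_zf(t,x,y,z)\|_2\le C_{f,z}$, $\sup_{t,x,y}\|D_y\sigma(t,x,y)\|_2\le C_{\sigma,y}$, $\sup_{t,x,y}\|\sigma(t,x,y)\|_2\le C_\sigma$; (A2) for each $n=0,\dots,N-1$, the map $(x,\theta_n)\mapsto\phi_n(x;\theta_n)$ is differentiable in $(x,\theta_n)$ and the mixed derivative $\partial_{\theta_n}\partial_x\phi_n$ exists. Then for every $i\in\{0,\dots,N-2\}$ the gradient of the total loss $\mathcal L$ satisfies $$\nabla_{\theta_i}\mathcal L=\frac{2\Delta t_i}{T}\bigl(\partial_{\theta_i}\phi_i(\widetilde{\mathcal X}_i;\theta_i)\bigr)^\top(\widehat Y_i-\widetilde Y_i)+\frac{2\Delta t_{i+1}}{T}\bigl(\partial_{\theta_i}\widetilde Y_{i+1}\bigr)^\top(\widetilde Y_{i+1}-\widehat Y_{i+1})+R_{i+1},$$ where $$R_{i+1}:=2\bigl(\partial_{\theta_i}\widetilde Y_{i+1}\bigr)^\top\Bigl[\sum_{j=i+2}^{N-1}\frac{\Delta t_j}{T}\Bigl(\prod_{n=i+1}^{j-1}H_n\Bigr)^\top(\widetilde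 Y_j-\widehat Y_j)+\Bigl(\prod_{n=i+1}^{N-1}H_n\Bigr)^\top(\widetilde Y_N-g(\widetilde X_N))\Bigr].$$
   Context: Setting. $T>0$, $0=t_0<t_1<\dots<t_N=T$, $\Delta t_n=t_{n+1}-t_n$. The maps $b:[0,T]\times\mathbb{R}^d\times\mathbb{R}^m\times\mathbb{R}^{m\times d}\to\mathbb{R}^d$, $\sigma:[0,T]\times\mathbb{R}^d\times\mathbb{R}^m\to\mathbb{R}^{d\times d}$, $f:[0,T]\times\mathbb{R}^d\times\mathbb{R}^m\times\mathbb{R}^{m\times d}\to\mathbb{R}^m$, $g:\mathbb{R}^d\to\mathbb{R}^m$ are measurable. A Brownian sample is fixed, so $\Delta W_n\in\mathbb{R}^d$ ($n=0,\dots,N-1$) are fixed vectors; all identities are pathwise. The trainable parameters are $\Theta=\{\theta_{u_0},\theta_0,\dots,\theta_{N-1}\}$ (independent variables, $\theta_{u_0}\in\mathbb{R}^m$, each $\theta_n$ a finite-dimensional vector), and $\phi_n(\cdot;\theta_n):\mathbb{R}^d\to\mathbb{R}^m$ are networks. Given reference points $\widetilde{\mathcal X}_n\in\mathbb{R}^d$, set for $n=0,\dots,N-1$ $$\widehat Y_n=\phi_n(\widetilde{\mathcal X}_n;\theta_n),\qquad \widetilde Z_n=\partial_x\phi_n(\widetilde{\mathcal X}_n;\theta_n)\,\sigma(t_n,\widetilde{\mathcal X}_n,\widehat Y_n),$$ $$\widetilde Y_0=\theta_{u_0},\qquad \widetilde Y_{n+1}=\widetilde Y_n-f(t_n,\widetilde{\mathcal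 X}_n,\widetilde Y_n,\widetilde Z_n)\Delta t_n+\widetilde Z_n\Delta W_n,$$ $$\widetilde X_0=x_0,\qquad \widetilde X_{n+1}=\widetilde X_n+b(t_n,\widetilde X_n,\mathrm{sg}(\widetilde Y_n),\mathrm{sg}(\widetilde Z_n))\Delta t_n+\sigma(t_n,\widetilde X_n,\mathrm{sg}(\widetilde Y_n))\Delta W_n.$$ Differentiation convention: $\mathrm{sg}(\cdot)$ (stop-gradient) leaves the numerical value unchanged but its argument is treated as a constant when differentiating with respect to the parameters. Thus, in every parameter derivative, all $\widetilde X_n$ (in particular $\widetilde X_N$) are constants; likewise the reference points $\widetilde{\mathcal X}_n$ are frozen (constants). Losses: $\mathcal L_T:=|\widetilde Y_N-g(\widetilde X_N)|^2$, $\mathcal L_C:=\frac1T\sum_{n=0}^{N-1}|\widetilde Y_n-\widehat Y_n|^2\Delta t_n$, $\mathcal L:=\mathcal L_T+\mathcal L_C$. Propagation matrices: $H_n:=I_m-D_yf(t_n,\widetilde{\mathcal X}_n,\widetilde Y_n,\widetilde Z_n)\Delta t_n$. Products are ordered as $\prod_{n=a}^bH_n:=H_bH_{b-1}\cdots H_a$ for $a\le b$; empty products are identity matrices and empty sums are $0$. $|\cdot|$ is the Euclidean norm; $\|\cdot\|_2$ is the induced matrix 2-norm and, for derivatives of vector- or matrix-valued maps, the operator norm induced by Euclidean norms on vectors and Frobenius norms on matrices. $\partial_{\theta_i}v$ is the Jacobian of $v$ in $\theta_i$ and $\nabla_{\theta_i}$ the (column) gradient. *)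

theory Defs
  imports "HOL-Analysis.Analysis"
begin

section \<open>Derivatives\<close>

text \<open>Here \<open>C\<^sup>1\<close> means Frechet differentiable everywhere, with a derivative that is continuous in the
  operator norm.\<close>

definition C1_map :: "('a::real_normed_vector \<Rightarrow> 'b::real_normed_vector) \<Rightarrow> bool" where
  "C1_map F \<longleftrightarrow>
     (\<exists>F' :: 'a \<Rightarrow> 'a \<Rightarrow>\<^sub>L 'b.
        (\<forall>p. (F has_derivative blinfun_apply (F' p)) (at p)) \<and> continuous_on UNIV F')"

text \<open>The parameter vectors of the individual networks may have different dimensions. The parameter
  space of a network is therefore the coordinate subspace of \<open>real^'p\<close> belonging to a set \<open>K\<close> of
  coordinates; it is a copy of the Euclidean space of dimension \<open>card K\<close>. Parameter derivatives are
  taken within this subspace. Gradients and Jacobians have the partial derivatives in the directions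
  \<open>k \<in> K\<close> as entries and are padded with zeros at the coordinates outside \<open>K\<close>, which are not
  parameters. For \<open>K = UNIV\<close> one gets the ordinary gradient and \<^const>\<open>jacobian\<close>.\<close>

definition coord_space :: "'p::finite set \<Rightarrow> (real^'p) set" where
  "coord_space K = {v. \<forall>k. k \<notin> K \<longrightarrow> v $ k = 0}"

definition param_jacobian ::
    "'p::finite set \<Rightarrow> (real^'p \<Rightarrow> real^'m) \<Rightarrow> real^'p \<Rightarrow> real^'p^'m::finite" where
  "param_jacobian K F v =
     (\<chi> a k. if k \<in> K then frechet_derivative F (at v within coord_space K) (axis k 1) $ a else 0)"

definition param_gradient :: "'p::finite set \<Rightarrow> (real^'p \<Rightarrow> real) \<Rightarrow> real^'p \<Rightarrow> real^'p" where
  "param_gradient K F v =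
     (\<chi> k. if k \<in> K then frechet_derivative F (at v within coord_space K) (axis k 1) else 0)"


section \<open>The numerical scheme\<close>

text \<open>The data of the scheme. The time arguments of \<open>drift\<close>, \<open>diffusion\<close> and \<open>driver\<close> range over
  \<open>{0..horizon}\<close>. Of the sequences, only the entries \<open>grid 0, \<dots>, grid steps\<close> and the entries with
  index below \<open>steps\<close> of \<open>noise\<close> (the Brownian increments), \<open>refpt\<close> (the frozen reference points),
  \<open>net\<close> and \<open>pcoords\<close> matter. The parameter of \<open>net n\<close> ranges over
  \<open>coord_space (pcoords n)\<close>.\<close>

record ('d, 'm, 'p) scheme =
  horizon :: real
  steps :: nat
  grid :: "nat \<Rightarrow> real"
  drift :: "real \<Rightarrow> real^'d::finite \<Rightarrow> real^'m::finite \<Rightarrow> real^'d^'m \<Rightarrow> real^'d"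
  diffusion :: "real \<Rightarrow> real^'d \<Rightarrow> real^'m \<Rightarrow> real^'d^'d"
  driver :: "real \<Rightarrow> real^'d \<Rightarrow> real^'m \<Rightarrow> real^'d^'m \<Rightarrow> real^'m"
  terminal :: "real^'d \<Rightarrow> real^'m"
  noise :: "nat \<Rightarrow> real^'d"
  init :: "real^'d"
  refpt :: "nat \<Rightarrow> real^'d"
  pcoords :: "nat \<Rightarrow> 'p::finite set"
  net :: "nat \<Rightarrow> real^'d \<Rightarrow> real^'p \<Rightarrow> real^'m"

definition dt :: "('d::finite, 'm::finite, 'p::finite) scheme \<Rightarrow> nat \<Rightarrow> real" where
  "dt S n = grid S (Suc n) - grid S n"

text \<open>In the following, \<open>u\<close> is the trainable initial value and \<open>\<theta> n\<close> the parameter of the \<open>n\<close>-th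
  network.\<close>

definition Yhat ::
    "('d::finite, 'm::finite, 'p::finite) scheme \<Rightarrow> (nat \<Rightarrow> real^'p) \<Rightarrow> nat \<Rightarrow> real^'m" where
  "Yhat S \<theta> n = net S n (refpt S n) (\<theta> n)"

definition Ztil ::
    "('d::finite, 'm::finite, 'p::finite) scheme \<Rightarrow> (nat \<Rightarrow> real^'p) \<Rightarrow> nat \<Rightarrow> real^'d^'m" where
  "Ztil S \<theta> n =
     jacobian (\<lambda>x. net S n x (\<theta> n)) (at (refpt S n))
       ** diffusion S (grid S n) (refpt S n) (Yhat S \<theta> n)"

primrec Ytil ::
    "('d::finite, 'm::finite, 'p::finite) scheme \<Rightarrow> real^'m \<Rightarrow> (nat \<Rightarrow> real^'p) \<Rightarrow> nat \<Rightarrow> real^'m"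
  where
  "Ytil S u \<theta> 0 = u"
| "Ytil S u \<theta> (Suc n) =
     Ytil S u \<theta> n
       - dt S n *\<^sub>R driver S (grid S n) (refpt S n) (Ytil S u \<theta> n) (Ztil S \<theta> n)
       + Ztil S \<theta> n *v noise S n"

primrec Xtil ::
    "('d::finite, 'm::finite, 'p::finite) scheme \<Rightarrow> real^'m \<Rightarrow> (nat \<Rightarrow> real^'p) \<Rightarrow> nat \<Rightarrow> real^'d"
  where
  "Xtil S u \<theta> 0 = init S"
| "Xtil S u \<theta> (Suc n) =
     Xtil S u \<theta> n
       + dt S n *\<^sub>R drift S (grid S n) (Xtil S u \<theta> n) (Ytil S u \<theta> n) (Ztil S \<theta> n)
       + diffusion S (grid S n) (Xtil S u \<theta> n) (Ytil S u \<theta> n) *v noise S n"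


section \<open>Losses\<close>

text \<open>The stop-gradient operator acts on every occurrence of the parameters in the forward process
  \<^const>\<open>Xtil\<close>. It is modelled by two copies of the parameters: the detached copy \<open>(u', \<theta>')\<close> is
  used for the forward process and is held fixed under differentiation, the live copy \<open>(u, \<theta>)\<close> is
  the one differentiated. The value of a loss is obtained by letting the two copies coincide; a
  derivative of it is taken in the live copy and then evaluated where the two copies coincide.\<close>

definition terminal_loss ::
    "('d::finite, 'm::finite, 'p::finite) scheme \<Rightarrow> real^'m \<Rightarrow> (nat \<Rightarrow> real^'p)
       \<Rightarrow> real^'m \<Rightarrow> (nat \<Rightarrow> real^'p) \<Rightarrow> real" where
  "terminal_loss S u' \<theta>' u \<theta> =
     (norm (Ytil S u \<theta> (steps S) - terminal S (Xtil S u' \<theta>' (steps S))))\<^sup>2"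

definition consistency_loss ::
    "('d::finite, 'm::finite, 'p::finite) scheme \<Rightarrow> real^'m \<Rightarrow> (nat \<Rightarrow> real^'p) \<Rightarrow> real" where
  "consistency_loss S u \<theta> =
     (1 / horizon S) * (\<Sum>n<steps S. (norm (Ytil S u \<theta> n - Yhat S \<theta> n))\<^sup>2 * dt S n)"

definition total_loss ::
    "('d::finite, 'm::finite, 'p::finite) scheme \<Rightarrow> real^'m \<Rightarrow> (nat \<Rightarrow> real^'p)
       \<Rightarrow> real^'m \<Rightarrow> (nat \<Rightarrow> real^'p) \<Rightarrow> real" where
  "total_loss S u' \<theta>' u \<theta> = terminal_loss S u' \<theta>' u \<theta> + consistency_loss S u \<theta>"


section \<open>Propagation of the gradient\<close>

definition propH ::
    "('d::finite, 'm::finite, 'p::finite) scheme \<Rightarrow> real^'m \<Rightarrow> (nat \<Rightarrow> real^'p) \<Rightarrow> nat \<Rightarrow> real^'m^'m"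
  where
  "propH S u \<theta> n =
     mat 1 - dt S n *\<^sub>R
       jacobian (\<lambda>y. driver S (grid S n) (refpt S n) y (Ztil S \<theta> n)) (at (Ytil S u \<theta> n))"

text \<open>The ordered product \<open>H b ** \<dots> ** H (a + 1) ** H a\<close>, which is the identity for \<open>b < a\<close>.\<close>

definition ordered_prod :: "(nat \<Rightarrow> real^'m^'m::finite) \<Rightarrow> nat \<Rightarrow> nat \<Rightarrow> real^'m^'m" where
  "ordered_prod H a b = foldl (\<lambda>A n. H n ** A) (mat 1) [a..<Suc b]"

text \<open>The Jacobian of \<open>Ytil n\<close> in the parameter of the \<open>i\<close>-th network.\<close>

definition dYtil ::
    "('d::finite, 'm::finite, 'p::finite) scheme \<Rightarrow> real^'m \<Rightarrow> (nat \<Rightarrow> real^'p) \<Rightarrow> nat \<Rightarrow> nat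
       \<Rightarrow> real^'p^'m" where
  "dYtil S u \<theta> i n = param_jacobian (pcoords S i) (\<lambda>v. Ytil S u (\<theta>(i := v)) n) (\<theta> i)"

text \<open>\<open>remainder S u \<theta> k i\<close> is the remainder \<open>R k\<close> in the formula for the gradient in the parameter
  of the \<open>i\<close>-th network; it is used with \<open>k = i + 1\<close>.\<close>

definition remainder ::
    "('d::finite, 'm::finite, 'p::finite) scheme \<Rightarrow> real^'m \<Rightarrow> (nat \<Rightarrow> real^'p) \<Rightarrow> nat \<Rightarrow> nat
       \<Rightarrow> real^'p" where
  "remainder S u \<theta> k i =
     2 *\<^sub>R (transpose (dYtil S u \<theta> i k) *v
       ((\<Sum>j=k+1..steps S - 1.
            (dt S j / horizon S) *\<^sub>R
              (transpose (ordered_prod (propH S u \<theta>) k (j - 1)) *v (Ytil S u \<theta> j - Yhat S \<theta> j)))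
        + transpose (ordered_prod (propH S u \<theta>) k (steps S - 1)) *v
            (Ytil S u \<theta> (steps S) - terminal S (Xtil S u \<theta> (steps S)))))"

end

theory Submission
  imports Defs
begin

text \<open>
  The parameter \<open>\<theta> i\<close> enters the recursion for \<^const>\<open>Ytil\<close> only through \<open>Ztil i\<close>, that is,
  in the step from \<open>i\<close> to \<open>i + 1\<close>. Before this step \<^const>\<open>Ytil\<close> does not depend on \<open>\<theta> i\<close> at all
  (\<open>Ytil_update_later\<close>). The step itself is differentiable in \<open>\<theta> i\<close> by the chain rule
  (\<open>Ztil_differentiable\<close>, \<open>Ytil_Suc_differentiable\<close>); write \<open>D\<close> for the derivative of
  \<open>Ytil (i + 1)\<close>. In every later step \<open>Ztil n\<close> is constant in \<open>\<theta> i\<close>, so \<open>\<theta> i\<close> acts through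
  \<open>Ytil n\<close> alone, and one step multiplies the derivative by the propagation matrix \<open>H n\<close>.
  Consequently the derivative of \<open>Ytil n\<close> is \<open>H (n - 1) ** \<dots> ** H (i + 1)\<close> applied to \<open>D\<close>
  (\<open>Ytil_has_derivative_propagate\<close>).

  The loss is a weighted sum of the squared norms of \<open>Ytil n - Yhat n\<close>, for \<open>n < N\<close>, and of
  \<open>Ytil N - g (Xtil N)\<close>, where \<open>g (Xtil N)\<close> is detached and hence constant. Differentiating term by
  term, the summands with \<open>n < i\<close> vanish; the summand \<open>n = i\<close> sees \<open>\<theta> i\<close> through \<open>Yhat i\<close> only and
  gives the first term of the formula; the summand \<open>n = i + 1\<close> involves the bare \<open>D\<close> and gives the
  second. All other terms carry a product of propagation matrices in front of \<open>D\<close>; moving this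
  product to the other side of the inner product yields its transpose, and what they add up to is
  the remainder.

  Since the parameters range over a coordinate subspace, a derivative within it is determined only
  in the directions of the subspace. These are the only directions in which gradients and Jacobians
  are evaluated, so any derivative found by the chain rule may be used to compute them
  (\<open>frechet_derivative_coord_space_axis\<close>). The claimed identity is then compared entry by entry.
\<close>

section \<open>Derivatives within a coordinate subspace\<close>

text \<open>The line through \<open>v\<close> in the direction of a coordinate \<open>k \<in> K\<close> stays in the coordinate
  subspace. Along it either candidate yields a derivative of a function of one real variable, and
  these are unique.\<close>

lemma has_derivative_coord_space_axis_unique:
  fixes F :: "real^'p::finite \<Rightarrow> 'b::real_normed_vector"
  assumes 1: "(F has_derivative F1) (at v within coord_space K)"
    and 2: "(F has_derivative F2) (at v within coord_space K)"
    and v: "v \<in> coord_space K" and k: "k \<in> K"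
  shows "F1 (axis k 1) = F2 (axis k 1)"
proof -
  have line: "((\<lambda>t. v + t *\<^sub>R axis k 1) has_derivative (\<lambda>t. t *\<^sub>R axis k (1::real))) (at 0)"
    by (auto intro!: derivative_eq_intros)
  have range: "range (\<lambda>t. v + t *\<^sub>R axis k 1) \<subseteq> coord_space K"
    using v k by (auto simp: coord_space_def axis_def)
  have comp: "((\<lambda>t. F (v + t *\<^sub>R axis k 1)) has_derivative (\<lambda>t. F' (t *\<^sub>R axis k 1))) (at 0)"
    if "(F has_derivative F') (at v within coord_space K)" for F'
    using has_derivative_in_compose[OF line, of F F'] has_derivative_subset[OF that range] by simp
  have "(\<lambda>t. F1 (t *\<^sub>R axis k 1)) = (\<lambda>t. F2 (t *\<^sub>R axis k 1))"
    by (rule has_derivative_unique[OF comp[OF 1] comp[OF 2]])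
  from fun_cong[OF this, of 1] show ?thesis by simp
qed

text \<open>\<^const>\<open>frechet_derivative\<close> is an arbitrary choice among the derivatives within the subspace, but
  on the axes in \<open>K\<close> the choice does not matter.\<close>

lemma frechet_derivative_coord_space_axis:
  fixes F :: "real^'p::finite \<Rightarrow> 'b::real_normed_vector"
  assumes F: "(F has_derivative F') (at v within coord_space K)"
    and v: "v \<in> coord_space K" and k: "k \<in> K"
  shows "frechet_derivative F (at v within coord_space K) (axis k 1) = F' (axis k 1)"
proof (rule has_derivative_coord_space_axis_unique[OF _ F v k])
  show "(F has_derivative frechet_derivative F (at v within coord_space K))
          (at v within coord_space K)"
    using F frechet_derivative_works differentiable_def by blast
qed

text \<open>The next two lemmas replace padded Jacobians and gradients by the values of a known derivative
  on the axes, which reduces an identity between gradients to one between real numbers.\<close>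

lemma transpose_param_jacobian_component:
  assumes "(F has_derivative F') (at v within coord_space K)" and "v \<in> coord_space K"
  shows "(transpose (param_jacobian K F v) *v w) $ k = (if k \<in> K then F' (axis k 1) \<bullet> w else 0)"
  using frechet_derivative_coord_space_axis[OF assms]
  by (auto simp: matrix_vector_mult_def transpose_def param_jacobian_def inner_vec_def)

lemma param_gradient_component:
  assumes "(F has_derivative F') (at v within coord_space K)" and "v \<in> coord_space K"
  shows "param_gradient K F v $ k = (if k \<in> K then F' (axis k 1) else 0)"
  using frechet_derivative_coord_space_axis[OF assms] by (simp add: param_gradient_def)


section \<open>Products, squared norms and partial maps\<close>

lemma inner_transpose_mult:
  fixes A :: "real^'n::finite^'m::finite"
  shows "x \<bullet> (transpose A *v w) = (A *v x) \<bullet> w"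
  by (metis dot_lmul_matrix inner_commute transpose_matrix_vector)

lemma bounded_bilinear_matrix_mult:
  "bounded_bilinear (\<lambda>(A :: real^'n::finite^'m::finite) (B :: real^'k::finite^'n). A ** B)"
  unfolding bilinear_conv_bounded_bilinear[symmetric] bilinear_def
  by (auto intro!: linearI simp: vec_eq_iff matrix_matrix_mult_def algebra_simps sum.distrib
      sum_distrib_left)

lemma bounded_linear_mult_vector:
  "bounded_linear (\<lambda>A :: real^'n::finite^'m::finite. A *v x)"
  unfolding linear_conv_bounded_linear[symmetric]
  by (auto intro!: linearI simp: vec_eq_iff matrix_vector_mult_def algebra_simps sum.distrib
      sum_distrib_left)

text \<open>The square of the norm, unlike the norm, is differentiable also where \<open>F\<close> vanishes.\<close>

lemma has_derivative_norm_square: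
  fixes F :: "'a::real_normed_vector \<Rightarrow> 'b::real_inner"
  assumes "(F has_derivative F') (at v within A)"
  shows "((\<lambda>v. (norm (F v))\<^sup>2) has_derivative (\<lambda>h. 2 * (F' h \<bullet> F v))) (at v within A)"
  unfolding power2_norm_eq_inner
  by (rule has_derivative_eq_rhs[OF has_derivative_inner[OF assms assms]])
     (simp add: inner_commute)

lemma C1_map_differentiable: "C1_map F \<Longrightarrow> F differentiable (at p)"
  unfolding C1_map_def differentiable_def by blast

lemma differentiable_slice:
  assumes "(\<lambda>(y, z). F y z) differentiable (at (y, z))"
  shows "(\<lambda>y. F y z) differentiable (at y)" and "(\<lambda>z. F y z) differentiable (at z)"
proof -
  have 1: "(\<lambda>y. (y, z)) differentiable (at y)" and 2: "(\<lambda>z. (y, z)) differentiable (at z)"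
    using has_derivative_Pair[OF has_derivative_ident has_derivative_const]
      has_derivative_Pair[OF has_derivative_const has_derivative_ident]
    unfolding differentiable_def by blast+
  from assms have "(\<lambda>(y, z). F y z) differentiable (at ((y, z)) within A)" for A
    by (rule differentiable_at_withinI)
  then show "(\<lambda>y. F y z) differentiable (at y)" "(\<lambda>z. F y z) differentiable (at z)"
    using differentiable_chain_within[OF 1, of "\<lambda>(y, z). F y z"]
      differentiable_chain_within[OF 2, of "\<lambda>(y, z). F y z"]
    by (simp_all add: o_def)
qed


section \<open>Dependence of the scheme on one network parameter\<close>

lemma Yhat_update_other: "n \<noteq> i \<Longrightarrow> Yhat S (\<theta>(i := v)) n = Yhat S \<theta> n"
  by (simp add: Yhat_def)

lemma Ztil_update_other: "n \<noteq> i \<Longrightarrow> Ztil S (\<theta>(i := v)) n = Ztil S \<theta> n"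
  by (simp add: Ztil_def Yhat_def)

text \<open>\<open>Ytil n\<close> is built from \<open>Ztil 0, \<dots>, Ztil (n - 1)\<close>, so it cannot see a parameter with
  index \<open>n\<close> or later.\<close>

lemma Ytil_update_later: "n \<le> i \<Longrightarrow> Ytil S u (\<theta>(i := v)) n = Ytil S u \<theta> n"
  by (induction n) (simp_all add: Ztil_update_other)

lemma ordered_prod_Suc:
  assumes "a \<le> Suc b"
  shows "ordered_prod H a (Suc b) = H (Suc b) ** ordered_prod H a b"
  using assms by (simp add: ordered_prod_def)

lemma Yhat_differentiable:
  assumes "(\<lambda>(x, v). net S i x v) differentiable (at (refpt S i, \<theta> i) within UNIV \<times> A)"
  shows "(\<lambda>v. Yhat S (\<theta>(i := v)) i) differentiable (at (\<theta> i) within A)"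
proof -
  have 1: "(\<lambda>v. (refpt S i, v)) differentiable (at (\<theta> i) within A)"
    using has_derivative_Pair[OF has_derivative_const has_derivative_ident]
    unfolding differentiable_def by blast
  have 2: "(\<lambda>(x, v). net S i x v) differentiable
      (at (refpt S i, \<theta> i) within (\<lambda>v. (refpt S i, v)) ` A)"
    by (rule differentiable_within_subset[OF assms]) auto
  show ?thesis
    using differentiable_chain_within[OF 1 2] by (simp add: Yhat_def o_def)
qed

text \<open>\<^const>\<open>Ztil\<close> is the product of \<open>\<partial>\<^sub>x \<phi>\<close>, whose derivative in the parameter is the mixed one, and
  of the diffusion matrix, which depends on the parameter through \<^const>\<open>Yhat\<close>.\<close>

lemma Ztil_differentiable:
  assumes net: "(\<lambda>(x, v). net S i x v) differentiable (at (refpt S i, \<theta> i) within UNIV \<times> A)"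
    and mixed: "(\<lambda>v. jacobian (\<lambda>x. net S i x v) (at (refpt S i))) differentiable (at (\<theta> i) within A)"
    and diffusion: "C1_map (\<lambda>y. diffusion S (grid S i) (refpt S i) y)"
  shows "(\<lambda>v. Ztil S (\<theta>(i := v)) i) differentiable (at (\<theta> i) within A)"
proof -
  have "(\<lambda>v. diffusion S (grid S i) (refpt S i) (Yhat S (\<theta>(i := v)) i))
      differentiable (at (\<theta> i) within A)"
    using differentiable_chain_within[OF Yhat_differentiable[where \<theta>=\<theta>, OF net]
        differentiable_at_withinI[OF C1_map_differentiable[OF diffusion]]]
    by (simp add: o_def)
  with mixed show ?thesis
    using bounded_bilinear.FDERIV[OF bounded_bilinear_matrix_mult]
    unfolding differentiable_def Ztil_def fun_upd_same by blast
qed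

text \<open>In the step from \<open>i\<close> to \<open>i + 1\<close> the value \<open>Ytil i\<close> is constant in \<open>\<theta> i\<close>, so the chain
  rule runs through \<open>Ztil i\<close> alone, that is, through the last argument of the driver and through the
  noise term.\<close>

lemma Ytil_Suc_differentiable:
  assumes Z: "(\<lambda>v. Ztil S (\<theta>(i := v)) i) differentiable (at (\<theta> i) within A)"
    and driver: "C1_map (\<lambda>(y, z). driver S (grid S i) (refpt S i) y z)"
  shows "(\<lambda>v. Ytil S u (\<theta>(i := v)) (i + 1)) differentiable (at (\<theta> i) within A)"
proof -
  let ?f = "driver S (grid S i) (refpt S i) (Ytil S u \<theta> i)"
  have "?f differentiable (at z)" for z
    using differentiable_slice(2)[OF C1_map_differentiable[OF driver]] .
  then have "(\<lambda>v. ?f (Ztil S (\<theta>(i := v)) i)) differentiable (at (\<theta> i) within A)"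
    using differentiable_chain_within[OF Z, of ?f] by (simp add: o_def differentiable_at_withinI)
  moreover have "(\<lambda>v. Ztil S (\<theta>(i := v)) i *v noise S i) differentiable (at (\<theta> i) within A)"
    using Z bounded_linear.has_derivative[OF bounded_linear_mult_vector]
    unfolding differentiable_def by blast
  ultimately show ?thesis
    by (simp add: Ytil_update_later)
qed

text \<open>The roles are now reversed: for \<open>n > i\<close> it is \<open>Ztil n\<close> that is constant in \<open>\<theta> i\<close>. The step
  \<open>y \<mapsto> y - \<Delta>t f(y, Ztil n) + const\<close> has the Jacobian \<open>H n\<close>, and the chain rule puts one
  more factor \<open>H n\<close> on the left of the product.\<close>

lemma Ytil_has_derivative_propagate:
  assumes D: "((\<lambda>v. Ytil S u (\<theta>(i := v)) (i + 1)) has_derivative D) (at (\<theta> i) within A)"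
    and driver: "\<And>n. i < n \<Longrightarrow> n < N \<Longrightarrow> C1_map (\<lambda>(y, z). driver S (grid S n) (refpt S n) y z)"
    and "i + 1 \<le> n" "n \<le> N"
  shows "((\<lambda>v. Ytil S u (\<theta>(i := v)) n) has_derivative
            (\<lambda>h. ordered_prod (propH S u \<theta>) (i + 1) (n - 1) *v D h)) (at (\<theta> i) within A)"
  using \<open>i + 1 \<le> n\<close> \<open>n \<le> N\<close>
proof (induction n rule: dec_induct)
  case base
  then show ?case using D by (simp add: ordered_prod_def del: Ytil.simps fun_upd_apply)
next
  case (step n)
  let ?P = "ordered_prod (propH S u \<theta>) (i + 1) (n - 1)"
  let ?f = "\<lambda>y. driver S (grid S n) (refpt S n) y (Ztil S \<theta> n)"
  let ?J = "jacobian ?f (at (Ytil S u \<theta> n))"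
  let ?Y = "\<lambda>v. Ytil S u (\<theta>(i := v)) n"
  have n: "i < n" "n < N" using step by auto
  have "?f differentiable (at (Ytil S u \<theta> n))"
    using differentiable_slice(1)[OF C1_map_differentiable[OF driver[OF n]]] .
  then have J: "(?f has_derivative (\<lambda>h. ?J *v h)) (at (Ytil S u \<theta> n))"
    by (simp add: jacobian_works)
  have Y: "(?Y has_derivative (\<lambda>h. ?P *v D h)) (at (\<theta> i) within A)"
    by (rule step.IH) (use step.prems in simp)
  have "((\<lambda>v. ?f (?Y v)) has_derivative (\<lambda>h. ?J *v (?P *v D h))) (at (\<theta> i) within A)"
    by (rule has_derivative_compose[OF Y]) (simp add: J)
  then have "((\<lambda>v. ?Y v - dt S n *\<^sub>R ?f (?Y v) + Ztil S \<theta> n *v noise S n) has_derivative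
      (\<lambda>h. ?P *v D h - dt S n *\<^sub>R (?J *v (?P *v D h)))) (at (\<theta> i) within A)"
    by (auto intro!: derivative_eq_intros Y)
  moreover have "ordered_prod (propH S u \<theta>) (i + 1) n = propH S u \<theta> n ** ?P"
    using ordered_prod_Suc[of "i + 1" "n - 1" "propH S u \<theta>"] n by simp
  then have "ordered_prod (propH S u \<theta>) (i + 1) (Suc n - 1) *v x
      = ?P *v x - dt S n *\<^sub>R (?J *v (?P *v x))" for x
    by (simp add: propH_def matrix_vector_mul_assoc[symmetric] matrix_vector_mult_diff_rdistrib
        scaleR_matrix_vector_assoc)
  ultimately show ?case
    using n by (simp add: Ztil_update_other del: fun_upd_apply)
qed


section \<open>The gradient of the loss\<close>

lemma sum_split_at:
  fixes F :: "nat \<Rightarrow> 'a::comm_monoid_add"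
  assumes "i + 2 \<le> N" and "\<And>n. n < i \<Longrightarrow> F n = 0"
  shows "(\<Sum>n<N. F n) = F i + (F (i + 1) + (\<Sum>n=i+2..N-1. F n))"
proof -
  have "(\<Sum>n<N. F n) = (\<Sum>n=i..<N. F n)"
    using assms by (intro sum.mono_neutral_right) auto
  also have "\<dots> = F i + (F (i + 1) + (\<Sum>n=i+2..<N. F n))"
    using assms(1) by (simp add: sum.atLeast_Suc_lessThan)
  also have "{i+2..<N} = {i+2..N-1}"
    using assms(1) by auto
  finally show ?thesis .
qed

theorem theorem4p1:
  fixes S :: "('d::finite, 'm::finite, 'p::finite) scheme"
    and u :: "real^'m" and \<theta> :: "nat \<Rightarrow> real^'p"
    and C_fz C_\<sigma>y C_\<sigma> :: real and i :: nat
  assumes T_pos: "horizon S > 0"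
    and grid_0: "grid S 0 = 0"
    and grid_mono: "\<And>n. n < steps S \<Longrightarrow> grid S n < grid S (Suc n)"
    and grid_N: "grid S (steps S) = horizon S"
    and drift_meas: "(\<lambda>(t, x, y, z). drift S t x y z)
          \<in> borel_measurable (restrict_space borel ({0..horizon S} \<times> UNIV))"
    and diffusion_meas: "(\<lambda>(t, x, y). diffusion S t x y)
          \<in> borel_measurable (restrict_space borel ({0..horizon S} \<times> UNIV))"
    and driver_meas: "(\<lambda>(t, x, y, z). driver S t x y z)
          \<in> borel_measurable (restrict_space borel ({0..horizon S} \<times> UNIV))"
    and terminal_meas: "terminal S \<in> borel_measurable borel"
    and \<theta>_space: "\<And>n. n < steps S \<Longrightarrow> \<theta> n \<in> coord_space (pcoords S n)"
    and driver_C1: "\<And>t x. t \<in> {0..horizon S} \<Longrightarrow> C1_map (\<lambda>(y, z). driver S t x y z)"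
    and diffusion_C1: "\<And>t x. t \<in> {0..horizon S} \<Longrightarrow> C1_map (\<lambda>y. diffusion S t x y)"
    and consts_pos: "C_fz > 0" "C_\<sigma>y > 0" "C_\<sigma> > 0"
    and Dz_driver_bound: "\<And>t x y z. t \<in> {0..horizon S} \<Longrightarrow>
          onorm (frechet_derivative (\<lambda>w. driver S t x y w) (at z)) \<le> C_fz"
    and Dy_diffusion_bound: "\<And>t x y. t \<in> {0..horizon S} \<Longrightarrow>
          onorm (frechet_derivative (\<lambda>w. diffusion S t x w) (at y)) \<le> C_\<sigma>y"
    and diffusion_bound: "\<And>t x y. t \<in> {0..horizon S} \<Longrightarrow>
          onorm (\<lambda>w. diffusion S t x y *v w) \<le> C_\<sigma>"
    and net_diff: "\<And>n x v. n < steps S \<Longrightarrow> v \<in> coord_space (pcoords S n) \<Longrightarrow>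
          (\<lambda>(x, v). net S n x v) differentiable
            (at (x, v) within UNIV \<times> coord_space (pcoords S n))"
    and net_mixed_diff: "\<And>n x v. n < steps S \<Longrightarrow> v \<in> coord_space (pcoords S n) \<Longrightarrow>
          (\<lambda>v. jacobian (\<lambda>x. net S n x v) (at x)) differentiable
            (at v within coord_space (pcoords S n))"
    and i_le: "i + 2 \<le> steps S"
  shows "(\<lambda>v. Ytil S u (\<theta>(i := v)) (i + 1)) differentiable
           (at (\<theta> i) within coord_space (pcoords S i))
    \<and> (\<lambda>v. total_loss S u \<theta> u (\<theta>(i := v))) differentiable
           (at (\<theta> i) within coord_space (pcoords S i))
    \<and> param_gradient (pcoords S i) (\<lambda>v. total_loss S u \<theta> u (\<theta>(i := v))) (\<theta> i)
         = (2 * dt S i / horizon S) *\<^sub>R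
             (transpose (param_jacobian (pcoords S i) (\<lambda>v. net S i (refpt S i) v) (\<theta> i))
               *v (Yhat S \<theta> i - Ytil S u \<theta> i))
         + (2 * dt S (i + 1) / horizon S) *\<^sub>R
             (transpose (dYtil S u \<theta> i (i + 1)) *v (Ytil S u \<theta> (i + 1) - Yhat S \<theta> (i + 1)))
         + remainder S u \<theta> (i + 1) i"
proof -
  let ?K = "pcoords S i"
  let ?V = "at (\<theta> i) within coord_space ?K"
  let ?N = "steps S"
  let ?P = "\<lambda>n. ordered_prod (propH S u \<theta>) (i + 1) (n - 1)"
  let ?e = "\<lambda>n. Ytil S u \<theta> n - Yhat S \<theta> n"
  let ?eN = "Ytil S u \<theta> ?N - terminal S (Xtil S u \<theta> ?N)"
  have i: "i < ?N" using i_le by simp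
  have \<theta>i: "\<theta> i \<in> coord_space ?K" by (rule \<theta>_space[OF i])
  \<comment> \<open>the smoothness hypotheses speak of times in \<open>[0, T]\<close>, so the grid points must be placed there\<close>
  have grid_time: "grid S n \<in> {0..horizon S}" if "n < ?N" for n
  proof -
    have mono: "grid S a \<le> grid S b" if "a \<le> b" "b \<le> ?N" for a b
      using that
    proof (induction b rule: dec_induct)
      case (step b)
      then show ?case using grid_mono[of b] by fastforce
    qed simp
    show ?thesis using mono[of 0 n] mono[of n ?N] that grid_0 grid_N by simp
  qed
  have driver: "C1_map (\<lambda>(y, z). driver S (grid S n) (refpt S n) y z)" if "n < ?N" for n
    using driver_C1[OF grid_time[OF that]] .

  have Y1: "(\<lambda>v. Ytil S u (\<theta>(i := v)) (i + 1)) differentiable ?V"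
    using Ytil_Suc_differentiable[OF Ztil_differentiable driver[OF i]]
      net_diff[OF i \<theta>i] net_mixed_diff[OF i \<theta>i] diffusion_C1[OF grid_time[OF i]] by blast
  then obtain D where D: "((\<lambda>v. Ytil S u (\<theta>(i := v)) (i + 1)) has_derivative D) ?V"
    unfolding differentiable_def by blast
  obtain D' where D': "((\<lambda>v. Yhat S (\<theta>(i := v)) i) has_derivative D') ?V"
    using Yhat_differentiable[where \<theta>=\<theta>, OF net_diff[OF i \<theta>i]] unfolding differentiable_def by blast
  have Y: "((\<lambda>v. Ytil S u (\<theta>(i := v)) n) has_derivative (\<lambda>h. ?P n *v D h)) ?V"
    if "i < n" "n \<le> ?N" for n
    by (rule Ytil_has_derivative_propagate[OF D driver _ that(2)]) (use that in auto)

  \<comment> \<open>the derivative of \<open>Ytil n - Yhat n\<close>: neither part sees \<open>\<theta> i\<close> below \<open>i\<close>, only \<open>Yhat\<close>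
      does at \<open>i\<close>, and only \<open>Ytil\<close> does above \<open>i\<close>\<close>
  define E where "E n = (if n < i then (\<lambda>h. 0) else if n = i then (\<lambda>h. - D' h)
      else (\<lambda>h. ?P n *v D h))" for n
  have E: "((\<lambda>v. Ytil S u (\<theta>(i := v)) n - Yhat S (\<theta>(i := v)) n) has_derivative E n) ?V"
    if "n < ?N" for n
  proof (cases n i rule: linorder_cases)
    case less
    then show ?thesis by (simp add: E_def Ytil_update_later Yhat_update_other del: fun_upd_apply)
  next
    case equal
    then show ?thesis
      using has_derivative_diff[OF has_derivative_const[of "Ytil S u \<theta> i"] D']
      by (simp add: E_def Ytil_update_later del: fun_upd_apply)
  next
    case greater
    then show ?thesis
      using has_derivative_diff[OF Y[of n] has_derivative_const[of "Yhat S \<theta> n"]] that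
      by (simp add: E_def Yhat_update_other del: fun_upd_apply)
  qed
  define L' where "L' h = 2 * ((?P ?N *v D h) \<bullet> ?eN)
      + 1 / horizon S * (\<Sum>n<?N. 2 * (E n h \<bullet> ?e n) * dt S n)" for h
  have YN: "((\<lambda>v. Ytil S u (\<theta>(i := v)) ?N - terminal S (Xtil S u \<theta> ?N)) has_derivative
      (\<lambda>h. ?P ?N *v D h)) ?V"
    using has_derivative_diff[OF Y[of ?N] has_derivative_const] i by simp
  have L: "((\<lambda>v. total_loss S u \<theta> u (\<theta>(i := v))) has_derivative L') ?V"
    unfolding total_loss_def terminal_loss_def consistency_loss_def L'_def
    using has_derivative_norm_square[OF YN] has_derivative_norm_square[OF E]
    by (intro has_derivative_add has_derivative_mult_right has_derivative_sum
        has_derivative_mult_left) simp_all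

  \<comment> \<open>the claimed formula in weak form, with each Jacobian still applied to a direction \<open>h\<close>\<close>
  have L'_eq: "L' h = 2 * dt S i / horizon S * (D' h \<bullet> (Yhat S \<theta> i - Ytil S u \<theta> i))
      + 2 * dt S (i + 1) / horizon S * (D h \<bullet> ?e (i + 1))
      + 2 * (D h \<bullet> ((\<Sum>j=i+2..?N-1. (dt S j / horizon S) *\<^sub>R (transpose (?P j) *v ?e j))
          + transpose (?P ?N) *v ?eN))" for h
  proof -
    have E_i: "E i h \<bullet> ?e i = D' h \<bullet> (Yhat S \<theta> i - Ytil S u \<theta> i)"
      by (simp add: E_def inner_diff_right)
    \<comment> \<open>the product in front of \<open>D\<close> is empty here, so the term is separated from the remainder\<close>
    have E_Suc: "E (i + 1) h = D h"
      by (simp add: E_def ordered_prod_def)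
    have "(\<Sum>n<?N. 2 * (E n h \<bullet> ?e n) * dt S n)
        = 2 * (E i h \<bullet> ?e i) * dt S i + (2 * (E (i + 1) h \<bullet> ?e (i + 1)) * dt S (i + 1)
          + (\<Sum>j=i+2..?N-1. 2 * (E j h \<bullet> ?e j) * dt S j))"
      by (rule sum_split_at[OF i_le]) (simp add: E_def)
    moreover have "(\<Sum>j=i+2..?N-1. 2 * (E j h \<bullet> ?e j) * dt S j)
        = (\<Sum>j=i+2..?N-1. 2 * ((?P j *v D h) \<bullet> ?e j) * dt S j)"
      by (rule sum.cong) (auto simp: E_def)
    ultimately have "L' h = 2 * ((?P ?N *v D h) \<bullet> ?eN)
        + 1 / horizon S * (2 * (D' h \<bullet> (Yhat S \<theta> i - Ytil S u \<theta> i)) * dt S i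
          + (2 * (D h \<bullet> ?e (i + 1)) * dt S (i + 1)
          + (\<Sum>j=i+2..?N-1. 2 * ((?P j *v D h) \<bullet> ?e j) * dt S j)))"
      unfolding L'_def E_i E_Suc by simp
    moreover have "2 * (D h \<bullet> ((\<Sum>j=i+2..?N-1. (dt S j / horizon S) *\<^sub>R (transpose (?P j) *v ?e j))
          + transpose (?P ?N) *v ?eN))
        = 2 * ((?P ?N *v D h) \<bullet> ?eN)
          + 1 / horizon S * (\<Sum>j=i+2..?N-1. 2 * ((?P j *v D h) \<bullet> ?e j) * dt S j)"
      unfolding inner_add_right inner_sum_right inner_scaleR_right inner_transpose_mult
        distrib_left sum_distrib_left
      by (simp del: One_nat_def Ytil.simps add: mult_ac)
    ultimately show ?thesis
      by (simp only: distrib_left) (simp del: Ytil.simps add: ac_simps)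
  qed

  have "param_gradient ?K (\<lambda>v. total_loss S u \<theta> u (\<theta>(i := v))) (\<theta> i) $ k
      = ((2 * dt S i / horizon S) *\<^sub>R
             (transpose (param_jacobian ?K (\<lambda>v. net S i (refpt S i) v) (\<theta> i))
               *v (Yhat S \<theta> i - Ytil S u \<theta> i))
         + (2 * dt S (i + 1) / horizon S) *\<^sub>R
             (transpose (dYtil S u \<theta> i (i + 1)) *v ?e (i + 1))
         + remainder S u \<theta> (i + 1) i) $ k" for k
  proof -
    have D'': "(net S i (refpt S i) has_derivative D') ?V"
      using D' by (simp add: Yhat_def)
    show ?thesis
      unfolding remainder_def dYtil_def vector_add_component vector_scaleR_component
        param_gradient_component[OF L \<theta>i] transpose_param_jacobian_component[OF D'' \<theta>i]
        transpose_param_jacobian_component[OF D \<theta>i] L'_eq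
      by simp
  qed
  moreover have "(\<lambda>v. total_loss S u \<theta> u (\<theta>(i := v))) differentiable ?V"
    using L unfolding differentiable_def by blast
  ultimately show ?thesis
    using Y1 by (auto simp: vec_eq_iff)
qed

end
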